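(* Let $\Omega\subset\mathbb{R}^n$ be a domain. Assume that $W\in C^1(\mathcal{L}(\mathbb{R}^n))$ is frame indifferent and strictly rank-one convex. Let $u\in W^{1,\infty}(\Omega,\mathbb{R}^n)$ satisfy the differential inclusion $Du(x)\in O(\mathbb{R}^n)$ for a.e. $x\in\Omega$, and suppose that $u$ is not $C^1$ in $\Omega$. Then $u$ is not a weak solution of the Euler-Lagrange equations $$\operatorname{div} DW(Du(x))=0 \quad\text{in }\Omega.$$
   Context: $\mathcal{L}(\mathbb{R}^n)$ is the space of linear maps $\mathbb{R}^n\to\mathbb{R}^n$ with inner product $\langle X,Y\rangle=\operatorname{tr}(X^\ast Y)$; $O(\mathbb{R}^n)=\{X\in\mathcal{L}(\mathbb{R}^n):X^\ast X=I\}$; $DW(X)\in\mathcal{L}(\mathbb{R}^n)$ is the gradient of $W:\mathcal{L}(\mathbb{R}^n)\to\mathbb{R}$ with respect to this inner product. $W$ is frame indifferent if $W(RX)=W(X)$ for all $X\in\mathcal{L}(\mathbb{R}^n)$ and all $R\in O(\mathbb{R}^n)$. $W$ is strictly rank-one convex if for every $A,B\in\mathcal{L}(\mathbb{R}^n)$ with $\operatorname{rank}(B)=1$ the function $t\mapsto W(A+tB)$ is strictly convex on $\mathbb{R}$. A map $u\in W^{1,\infty}(\Omega,\mathbb{R}^n)$ is a weak solution of the Euler-Lagrange equations if $\int_\Omega\langle DW(Du(x)),D\varphi(x)\rangle\,dx=0$ for all $\varphi\in C_0^\infty(\Omega,\mathbb{R}^n)$. Elements of $W^{1,\infty}$ are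 identified with their continuous representatives. *)

theory Defs
  imports "HOL-Analysis.Analysis"
begin

text \<open>
  \<open>C\<^sup>k\<close> regularity; meant for open sets \<open>S\<close>, where the Frechet derivative at a point of \<open>S\<close> is
  determined by the values of \<open>f\<close> on \<open>S\<close>. Taking all directional derivatives
  \<open>x \<mapsto> f'(x) v\<close> amounts to the usual definition because the domain is finite-dimensional.
\<close>

primrec Ck_on :: "nat \<Rightarrow> 'a::euclidean_space set \<Rightarrow> ('a \<Rightarrow> 'b::real_normed_vector) \<Rightarrow> bool" where
  "Ck_on 0 S f \<longleftrightarrow> continuous_on S f"
| "Ck_on (Suc k) S f \<longleftrightarrow>
     (\<forall>x\<in>S. f differentiable (at x)) \<and> (\<forall>v. Ck_on k S (\<lambda>x. frechet_derivative f (at x) v))"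

text \<open>
  \<open>C\<^sub>0\<^sup>\<infinity>(\<Omega>)\<close>: smooth functions with compact support in \<open>\<Omega>\<close>, represented by their extension by zero.
\<close>

definition test_functions :: "'a::euclidean_space set \<Rightarrow> ('a \<Rightarrow> 'b::real_normed_vector) set" where
  "test_functions \<Omega> =
     {\<phi>. (\<forall>k. Ck_on k UNIV \<phi>) \<and> compact (closure {x. \<phi> x \<noteq> 0}) \<and> closure {x. \<phi> x \<noteq> 0} \<subseteq> \<Omega>}"

definition locally_integrable_on ::
    "'a::euclidean_space set \<Rightarrow> ('a \<Rightarrow> 'b::euclidean_space) \<Rightarrow> bool" where
  "locally_integrable_on \<Omega> f \<longleftrightarrow>
     (\<forall>K. compact K \<and> K \<subseteq> \<Omega> \<longrightarrow> set_integrable lebesgue K f)"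

definition Linf :: "'a::euclidean_space set \<Rightarrow> ('a \<Rightarrow> 'b::euclidean_space) set" where
  "Linf \<Omega> = {f \<in> borel_measurable (lebesgue_on \<Omega>). \<exists>C. AE x in lebesgue_on \<Omega>. norm (f x) \<le> C}"

text \<open>
  \<open>G\<close> is a representative of the weak derivative of \<open>u\<close>: \<open>G x $ i $ j\<close> is the weak partial derivative
  of the \<open>i\<close>-th component in direction \<open>j\<close>, the same convention as for \<^const>\<open>jacobian\<close>.
\<close>

definition has_weak_jacobian ::
    "(real^'n) set \<Rightarrow> (real^'n \<Rightarrow> real^'m) \<Rightarrow> (real^'n \<Rightarrow> real^'n^'m) \<Rightarrow> bool" where
  "has_weak_jacobian \<Omega> u G \<longleftrightarrow>
     locally_integrable_on \<Omega> u \<and> locally_integrable_on \<Omega> G \<and>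
     (\<forall>\<phi> \<in> test_functions \<Omega>. \<forall>i j.
        (LINT x:\<Omega>|lebesgue. u x $ i * frechet_derivative \<phi> (at x) (axis j 1))
        = - (LINT x:\<Omega>|lebesgue. G x $ i $ j * \<phi> x))"

text \<open>
  The weak derivative \<open>Du\<close> is unique up to null sets only; this picks one representative.
\<close>

definition weak_jacobian ::
    "(real^'n) set \<Rightarrow> (real^'n \<Rightarrow> real^'m) \<Rightarrow> real^'n \<Rightarrow> real^'n^'m" where
  "weak_jacobian \<Omega> u = (SOME G. has_weak_jacobian \<Omega> u G)"

text \<open>
  \<open>W\<^sup>1\<^sup>,\<^sup>\<infinity>(\<Omega>)\<close> as a set of functions, not of equivalence classes. Only the values on
  \<open>\<Omega>\<close> matter, and no continuous representative is singled out here.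
\<close>

definition W1inf :: "(real^'n) set \<Rightarrow> (real^'n \<Rightarrow> real^'m) set" where
  "W1inf \<Omega> = {u \<in> Linf \<Omega>. \<exists>G \<in> Linf \<Omega>. has_weak_jacobian \<Omega> u G}"

text \<open>
  The space of linear maps on \<open>\<real>\<^sup>n\<close> is the matrix type \<open>real^'n^'n\<close>, whose inner product
  is the trace product.
\<close>

lemma inner_matrix_eq_trace: "inner X Y = trace (transpose X ** Y)"
  for X Y :: "real^'n^'n"
  unfolding inner_vec_def trace_def matrix_matrix_mult_def transpose_def
  by simp (rule sum.swap)

definition gradient :: "('a::real_inner \<Rightarrow> real) \<Rightarrow> 'a \<Rightarrow> 'a" where
  "gradient W X = (THE D. GDERIV W X :> D)"

lemma gradient_eqI: "GDERIV W X :> D \<Longrightarrow> gradient W X = D"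
  unfolding gradient_def gderiv_def
proof (rule the_equality, assumption)
  fix D' assume "(W has_derivative (\<lambda>h. inner h D')) (at X)"
    and "(W has_derivative (\<lambda>h. inner h D)) (at X)"
  then have "(\<lambda>h. inner h D') = (\<lambda>h. inner h D)"
    by (rule has_derivative_unique)
  then have "inner h D' = inner h D" for h
    by (rule fun_cong)
  then have "inner (D' - D) (D' - D) = 0"
    by (simp only: inner_diff_right)
  then show "D' = D"
    by simp
qed

definition frame_indifferent :: "(real^'n^'n \<Rightarrow> real) \<Rightarrow> bool" where
  "frame_indifferent W \<longleftrightarrow> (\<forall>R X. orthogonal_matrix R \<longrightarrow> W (R ** X) = W X)"

definition strictly_convex_on :: "'a::real_vector set \<Rightarrow> ('a \<Rightarrow> real) \<Rightarrow> bool" where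
  "strictly_convex_on S f \<longleftrightarrow> convex S \<and>
     (\<forall>x\<in>S. \<forall>y\<in>S. \<forall>t. x \<noteq> y \<and> 0 < t \<and> t < 1 \<longrightarrow>
        f ((1 - t) *\<^sub>R x + t *\<^sub>R y) < (1 - t) * f x + t * f y)"

definition strictly_rank_one_convex :: "(real^'n^'n \<Rightarrow> real) \<Rightarrow> bool" where
  "strictly_rank_one_convex W \<longleftrightarrow>
     (\<forall>A B. rank B = 1 \<longrightarrow> strictly_convex_on UNIV (\<lambda>t::real. W (A + t *\<^sub>R B)))"

definition weak_solution_EL ::
    "(real^'n^'n \<Rightarrow> real) \<Rightarrow> (real^'n) set \<Rightarrow> (real^'n \<Rightarrow> real^'n) \<Rightarrow> bool" where
  "weak_solution_EL W \<Omega> u \<longleftrightarrow> u \<in> W1inf \<Omega> \<and>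
     (\<forall>\<phi> \<in> test_functions \<Omega>.
        (LINT x:\<Omega>|lebesgue. inner (gradient W (weak_jacobian \<Omega> u x)) (jacobian \<phi> (at x))) = 0)"

end

theory Submission
  imports Defs
begin

text \<open>
  Frame indifference gives \<open>DW(R) = R S\<close> for orthogonal \<open>R\<close>, where \<open>S = DW(I)\<close>. The function
  \<open>t \<mapsto> W(I - t b\<otimes>b)\<close>, \<open>|b| = 1\<close>, is strictly convex and takes equal values at \<open>0\<close> and at \<open>2\<close>
  (a reflection), so its derivative \<open>-\<langle>S b, b\<rangle>\<close> at \<open>0\<close> is negative. Hence for \<open>Du \<in> O(n)\<close> the
  Euler-Lagrange system says that every component of \<open>u\<close> is a weak solution of the scalar elliptic
  equation \<open>\<Sum> S\<^sub>k\<^sub>j \<partial>\<^sub>k \<partial>\<^sub>j v = 0\<close> with constant coefficients, and a Weyl lemma makes it \<open>C\<^sup>1\<close>.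

  For the Weyl lemma let \<open>A\<close> be the inverse of the symmetric part of \<open>S\<close>, \<open>q(z) = \<langle>z, A z\<rangle>\<close>, and let
  \<open>F\<close> be smooth with \<open>F = 0\<close> on \<open>[1, \<infinity>)\<close>. The kernels \<open>\<tau>\<^sup>n F'(\<tau>\<^sup>2 q)\<close> have constant mass, and their
  \<open>\<tau>\<close>-derivative is a multiple of the elliptic operator applied to the test function \<open>F(\<tau>\<^sup>2 q)\<close>.
  So the mollifications of a weak solution do not depend on \<open>\<tau>\<close>, and letting \<open>\<tau> \<rightarrow> \<infinity>\<close> shows that
  they are multiples of the solution itself.
\<close>

subsection \<open>Smooth cutoff functions\<close>

text \<open>The factor \<open>p (1 / s)\<close> is carried along because the family of functions
  \<open>p (1 / s) * exp (- (1 / s))\<close> is closed under differentiation.\<close>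

definition flat_exp :: "real poly \<Rightarrow> real \<Rightarrow> real" where
  "flat_exp p s = (if s \<le> 0 then 0 else poly p (1 / s) * exp (- (1 / s)))"

lemma tendsto_poly_times_exp_minus:
  fixes p :: "real poly"
  shows "((\<lambda>t. poly p t * exp (- t)) \<longlongrightarrow> 0) at_top"
proof -
  have "((\<lambda>t. \<Sum>i\<le>degree p. coeff p i * (t ^ i / exp t)) \<longlongrightarrow> (\<Sum>i\<le>degree p. coeff p i * 0)) at_top"
    by (intro tendsto_intros tendsto_power_div_exp_0)
  then show ?thesis
    by (simp add: poly_altdef sum_distrib_right exp_minus divide_inverse mult.assoc)
qed

lemma flat_exp_tendsto_0: "((\<lambda>s. flat_exp p s) \<longlongrightarrow> 0) (at 0)"
proof -
  have right: "(flat_exp p \<longlongrightarrow> 0) (at_right 0)"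
  proof (rule Lim_transform_eventually)
    show "((\<lambda>s. poly p (inverse s) * exp (- inverse s)) \<longlongrightarrow> 0) (at_right 0)"
      by (rule filterlim_compose[OF tendsto_poly_times_exp_minus filterlim_inverse_at_top_right])
    show "\<forall>\<^sub>F s in at_right 0. poly p (inverse s) * exp (- inverse s) = flat_exp p s"
      by (auto simp: eventually_at_filter flat_exp_def inverse_eq_divide)
  qed
  have left: "(flat_exp p \<longlongrightarrow> 0) (at_left 0)"
    by (rule Lim_transform_eventually[OF tendsto_const])
       (auto simp: eventually_at_filter flat_exp_def)
  show ?thesis
    using left right by (simp add: filterlim_at_split)
qed

text \<open>Since \<open>t = 1 / s\<close> has derivative \<open>- t^2\<close>, differentiating
  \<open>p(t) exp (- t)\<close> gives \<open>t^2 (p(t) - p'(t)) exp (- t)\<close>; the factor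
  \<open>[:0, 0, 1:]\<close> is this \<open>t^2\<close>.\<close>

lemma flat_exp_has_derivative:
  "(flat_exp p has_real_derivative flat_exp ([:0, 0, 1:] * (p - pderiv p)) s) (at s)"
proof (cases s "0 :: real" rule: linorder_cases)
  case less
  have "((\<lambda>_. 0) has_real_derivative 0) (at s)"
    by simp
  then have "(flat_exp p has_real_derivative 0) (at s)"
    by (rule has_field_derivative_transform_within_open[where S = "{..<0}"])
       (use less in \<open>auto simp: flat_exp_def\<close>)
  with less show ?thesis
    by (simp add: flat_exp_def)
next
  case equal
  \<comment> \<open>The difference quotient at 0 only multiplies \<open>p\<close> by one more factor
    \<open>1 / h\<close>, so it is again a flat function and tends to 0.\<close>
  have "((\<lambda>h. flat_exp (p * [:0, 1:]) h) \<longlongrightarrow> 0) (at 0)"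
    by (rule flat_exp_tendsto_0)
  moreover have "flat_exp (p * [:0, 1:]) h = (flat_exp p (0 + h) - flat_exp p 0) / h" for h
    by (simp add: flat_exp_def)
  ultimately have "(flat_exp p has_real_derivative 0) (at 0)"
    unfolding DERIV_def by simp
  with equal show ?thesis
    by (simp add: flat_exp_def)
next
  case greater
  have "((\<lambda>s. poly p (1 / s) * exp (- (1 / s))) has_real_derivative
      flat_exp ([:0, 0, 1:] * (p - pderiv p)) s) (at s)"
    using greater
    by (auto intro!: derivative_eq_intros DERIV_chain2[OF poly_DERIV]
        simp: flat_exp_def field_simps power2_eq_square)
  then show ?thesis
    by (rule has_field_derivative_transform_within_open[where S = "{0<..}"])
       (use greater in \<open>auto simp: flat_exp_def\<close>)
qed

text \<open>All derivatives are recorded at once: \<open>F k\<close> is the k-th derivative of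
  \<open>F 0\<close>, so that inductions on the order of differentiability can shift the
  index.\<close>

lemma smooth_cutoff_exists:
  obtains F :: "nat \<Rightarrow> real \<Rightarrow> real"
  where "\<And>k s. (F k has_real_derivative F (Suc k) s) (at s)"
    and "\<And>k s. 1 \<le> s \<Longrightarrow> F k s = 0"
    and "\<And>s. s < 1 \<Longrightarrow> 0 < F 1 s"
proof
  define P where "P k = ((\<lambda>p. [:0, 0, 1:] * (p - pderiv p)) ^^ k) [:1 :: real:]" for k
  \<comment> \<open>Each derivative in \<open>1 - s\<close> costs a sign. The extra sign makes
    \<open>F 0 s = - exp (- 1 / (1 - s))\<close> for \<open>s < 1\<close>, which increases to 0, so
    that \<open>F 1\<close> is positive there.\<close>
  define F where "F k s = (-1) ^ Suc k * flat_exp (P k) (1 - s)" for k s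
  show "(F k has_real_derivative F (Suc k) s) (at s)" for k s
  proof -
    have "((\<lambda>s. flat_exp (P k) (1 - s)) has_real_derivative
        flat_exp (P (Suc k)) (1 - s) * (- 1)) (at s)"
      using flat_exp_has_derivative[of "P k"]
      by (intro DERIV_chain2[where g = "\<lambda>s. 1 - s"]) (auto intro!: derivative_eq_intros simp: P_def)
    from DERIV_cmult[OF this, of "(-1) ^ Suc k"] show ?thesis
      unfolding F_def by simp
  qed
  show "F k s = 0" if "1 \<le> s" for k s
    using that by (simp add: F_def flat_exp_def)
  show "0 < F 1 s" if "s < 1" for s
    using that by (simp add: F_def flat_exp_def P_def pderiv_pCons)
qed

subsection \<open>Calculus of \<open>C\<^sup>k\<close> functions and test functions\<close>

lemma Ck_on_SucI:
  assumes "\<And>x. (f has_derivative f' x) (at x)" and "\<And>v. Ck_on k UNIV (\<lambda>x. f' x v)"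
  shows "Ck_on (Suc k) UNIV f"
proof -
  have "frechet_derivative f (at x) = f' x" for x
    using assms(1) frechet_derivative_at by metis
  with assms show ?thesis
    by (auto simp: differentiable_def)
qed

lemma Ck_on_SucE:
  assumes "Ck_on (Suc k) UNIV f"
  obtains f' where "\<And>x. (f has_derivative f' x) (at x)" and "\<And>v. Ck_on k UNIV (\<lambda>x. f' x v)"
  using assms frechet_derivative_works by fastforce

lemma Ck_on_UNIV_Suc_imp: "Ck_on (Suc k) UNIV f \<Longrightarrow> Ck_on k UNIV f"
proof (induction k arbitrary: f)
  case 0
  then have "f differentiable at x" for x
    by simp
  then show ?case
    by (auto intro!: continuous_at_imp_continuous_on differentiable_imp_continuous_within)
next
  case (Suc k)
  from Suc.prems have "Ck_on (Suc k) UNIV (\<lambda>x. frechet_derivative f (at x) v)" for v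
    by (simp del: Ck_on.simps add: Ck_on.simps(2)[of "Suc k"])
  from Suc.IH[OF this] show ?case
    using Suc.prems by simp
qed

lemma Ck_on_const: "Ck_on k UNIV (\<lambda>x. c)"
proof (induction k arbitrary: c)
  case (Suc k)
  show ?case
    by (rule Ck_on_SucI[where f' = "\<lambda>_ _. 0"]) (auto intro: Suc)
qed (simp add: continuous_on_const)

lemma Ck_on_bounded_linear:
  assumes "bounded_linear f"
  shows "Ck_on k UNIV f"
proof (cases k)
  case 0
  then show ?thesis
    using assms by (simp add: linear_continuous_on)
next
  case (Suc j)
  show ?thesis
    unfolding Suc
    by (rule Ck_on_SucI[where f' = "\<lambda>_. f"])
       (auto intro: Ck_on_const bounded_linear_imp_has_derivative assms)
qed

lemma Ck_on_add:
  "Ck_on k UNIV f \<Longrightarrow> Ck_on k UNIV g \<Longrightarrow> Ck_on k UNIV (\<lambda>x. f x + g x)"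
proof (induction k arbitrary: f g)
  case (Suc k)
  obtain f' g' where "\<And>x. (f has_derivative f' x) (at x)" "\<And>v. Ck_on k UNIV (\<lambda>x. f' x v)"
    and "\<And>x. (g has_derivative g' x) (at x)" "\<And>v. Ck_on k UNIV (\<lambda>x. g' x v)"
    using Suc.prems by (metis Ck_on_SucE)
  then show ?case
    by (intro Ck_on_SucI[where f' = "\<lambda>x v. f' x v + g' x v"])
       (auto intro!: derivative_intros Suc.IH)
qed (auto intro: continuous_on_add)

lemma Ck_on_bounded_linear_compose:
  assumes "bounded_linear h"
  shows "Ck_on k UNIV f \<Longrightarrow> Ck_on k UNIV (\<lambda>x. h (f x))"
proof (induction k arbitrary: f)
  case 0
  then show ?case
    using assms by (simp add: bounded_linear.continuous_on)
next
  case (Suc k)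
  obtain f' where "\<And>x. (f has_derivative f' x) (at x)" "\<And>v. Ck_on k UNIV (\<lambda>x. f' x v)"
    using Suc.prems by (metis Ck_on_SucE)
  then show ?case
    by (intro Ck_on_SucI[where f' = "\<lambda>x v. h (f' x v)"])
       (auto intro!: bounded_linear.has_derivative[OF assms] Suc.IH)
qed

lemma Ck_on_mult:
  fixes f g :: "'a::euclidean_space \<Rightarrow> real"
  shows "Ck_on k UNIV f \<Longrightarrow> Ck_on k UNIV g \<Longrightarrow> Ck_on k UNIV (\<lambda>x. f x * g x)"
proof (induction k arbitrary: f g)
  case (Suc k)
  obtain f' g' where "\<And>x. (f has_derivative f' x) (at x)" "\<And>v. Ck_on k UNIV (\<lambda>x. f' x v)"
    and "\<And>x. (g has_derivative g' x) (at x)" "\<And>v. Ck_on k UNIV (\<lambda>x. g' x v)"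
    using Suc.prems by (metis Ck_on_SucE)
  \<comment> \<open>The product rule leaves one factor undifferentiated; its order has to be lowered
    from \<open>Suc k\<close> to \<open>k\<close> before the induction hypothesis applies.\<close>
  with Ck_on_UNIV_Suc_imp[OF Suc.prems(1)] Ck_on_UNIV_Suc_imp[OF Suc.prems(2)] show ?case
    by (intro Ck_on_SucI[where f' = "\<lambda>x v. f x * g' x v + f' x v * g x"])
       (auto intro!: has_derivative_mult Ck_on_add Suc.IH)
qed (auto intro: continuous_on_mult)

text \<open>By the chain rule a derivative of \<open>F m (q x)\<close> is
  \<open>F (Suc m) (q x)\<close> times a derivative of \<open>q\<close>, so the induction runs over
  all \<open>m\<close> simultaneously.\<close>

lemma Ck_on_compose_real:
  fixes F :: "nat \<Rightarrow> real \<Rightarrow> real" and q :: "'a::euclidean_space \<Rightarrow> real"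
  assumes F: "\<And>k s. (F k has_real_derivative F (Suc k) s) (at s)"
    and q: "\<And>k. Ck_on k UNIV q"
  shows "Ck_on k UNIV (\<lambda>x. F m (q x))"
proof (induction k arbitrary: m)
  case 0
  have "continuous_on UNIV (F m)"
    using F by (auto intro!: continuous_at_imp_continuous_on DERIV_isCont)
  moreover have "continuous_on UNIV q"
    using q[of 0] by simp
  ultimately show ?case
    by (auto intro: continuous_on_compose2)
next
  case (Suc k)
  obtain q' where q': "\<And>x. (q has_derivative q' x) (at x)" "\<And>v. Ck_on k UNIV (\<lambda>x. q' x v)"
    using q[of "Suc k"] by (metis Ck_on_SucE)
  have "((\<lambda>x. F m (q x)) has_derivative (\<lambda>v. F (Suc m) (q x) * q' x v)) (at x)" for x
    using has_derivative_compose[OF q'(1)[of x] F[of m "q x", unfolded has_field_derivative_def]] by simp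
  then show ?case
    by (rule Ck_on_SucI) (auto intro!: Ck_on_mult Suc.IH q')
qed

section \<open>Test functions and integrals against them\<close>

lemma test_functionsI:
  assumes "\<And>k. Ck_on k UNIV \<phi>" and "compact K" and "K \<subseteq> \<Omega>"
    and "\<And>x. x \<notin> K \<Longrightarrow> \<phi> x = 0"
  shows "\<phi> \<in> test_functions \<Omega>"
proof -
  have "closure {x. \<phi> x \<noteq> 0} \<subseteq> K"
    using assms(2,4) by (intro closure_minimal) (auto intro: compact_imp_closed)
  moreover from this have "compact (closure {x. \<phi> x \<noteq> 0})"
    using assms(2) compact_Int_closed by (metis closed_closure inf.absorb2)
  ultimately show ?thesis
    using assms unfolding test_functions_def by auto
qed

lemma test_functionsD:
  assumes "\<phi> \<in> test_functions \<Omega>"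
  shows "\<phi> differentiable (at x)" and "\<And>k. Ck_on k UNIV \<phi>"
    and "continuous_on T \<phi>" and "continuous_on T (\<lambda>x. frechet_derivative \<phi> (at x) v)"
proof -
  show Ck: "Ck_on k UNIV \<phi>" for k
    using assms by (simp add: test_functions_def)
  show "\<phi> differentiable (at x)"
    using Ck[of 1] by simp
  show "continuous_on T \<phi>"
    using Ck[of 0] by (auto intro: continuous_on_subset)
  show "continuous_on T (\<lambda>x. frechet_derivative \<phi> (at x) v)"
    using Ck[of 1] by (auto intro: continuous_on_subset)
qed

lemma frechet_derivative_outside_support:
  assumes "x \<notin> closure {x. \<phi> x \<noteq> 0}"
  shows "frechet_derivative \<phi> (at x) = (\<lambda>_. 0)"
proof -
  have "(\<phi> has_derivative (\<lambda>_. 0)) (at x)"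
  proof (rule has_derivative_transform_within_open)
    show "((\<lambda>_. 0) has_derivative (\<lambda>_. 0)) (at x)"
      by simp
    show "open (- closure {x. \<phi> x \<noteq> 0})"
      by (simp add: open_Compl)
    show "0 = \<phi> y" if "y \<in> - closure {x. \<phi> x \<noteq> 0}" for y
      using that closure_subset[of "{x. \<phi> x \<noteq> 0}"] by auto
  qed (use assms in auto)
  then show ?thesis
    using frechet_derivative_at by metis
qed

lemma test_functions_frechet_derivative:
  assumes "\<phi> \<in> test_functions \<Omega>"
  shows "(\<lambda>x. frechet_derivative \<phi> (at x) v) \<in> test_functions \<Omega>"
proof (rule test_functionsI[where K = "closure {x. \<phi> x \<noteq> 0}"])
  show "Ck_on k UNIV (\<lambda>x. frechet_derivative \<phi> (at x) v)" for k
    using test_functionsD(2)[OF assms, of "Suc k"] by simp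
qed (use assms in \<open>auto simp: test_functions_def frechet_derivative_outside_support\<close>)

lemma test_functions_scaleR:
  assumes "\<psi> \<in> test_functions \<Omega>"
  shows "(\<lambda>x. \<psi> x *\<^sub>R c) \<in> test_functions \<Omega>"
proof (rule test_functionsI[where K = "closure {x. \<psi> x \<noteq> 0}"])
  show "Ck_on k UNIV (\<lambda>x. \<psi> x *\<^sub>R c)" for k
    using test_functionsD(2)[OF assms]
    by (rule Ck_on_bounded_linear_compose[OF bounded_linear_scaleR_left])
  show "\<psi> x *\<^sub>R c = 0" if "x \<notin> closure {x. \<psi> x \<noteq> 0}" for x
    using that closure_subset[of "{x. \<psi> x \<noteq> 0}"] by auto
qed (use assms in \<open>auto simp: test_functions_def\<close>)

text \<open>Passes from the Lebesgue integral of the weak formulation to the gauge integral on a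
  box, for which differentiation under the integral sign is used below.\<close>

lemma set_lebesgue_integral_eq_integral_cbox:
  fixes g :: "'a::euclidean_space \<Rightarrow> real"
  assumes "continuous_on (cbox a b) g" and "cbox a b \<subseteq> \<Omega>" and "\<And>y. y \<in> \<Omega> - cbox a b \<Longrightarrow> g y = 0"
  shows "(LINT y:\<Omega>|lebesgue. g y) = integral (cbox a b) g"
proof -
  have "(LINT y:\<Omega>|lebesgue. g y) = (LINT y:cbox a b|lebesgue. g y)"
    using assms(2,3) unfolding set_lebesgue_integral_def
    by (intro Bochner_Integration.integral_cong) (auto simp: indicator_def)
  also have "\<dots> = integral (cbox a b) g"
    using assms(1) by (intro set_lebesgue_integral_eq_integral absolutely_integrable_continuous)
  finally show ?thesis .
qed

subsection \<open>A Weyl lemma\<close>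

definition second_order :: "real^'n^'n \<Rightarrow> (real^'n \<Rightarrow> real) \<Rightarrow> real^'n \<Rightarrow> real" where
  "second_order S \<psi> y = (\<Sum>k\<in>UNIV. \<Sum>j\<in>UNIV.
     S $ k $ j * frechet_derivative (\<lambda>z. frechet_derivative \<psi> (at z) (axis j 1)) (at y) (axis k 1))"

text \<open>For \<open>A\<close> the inverse of the symmetric part of \<open>S\<close>,
  \<open>trace_SA\<close> is the trace of the identity, and \<open>ASA\<close> holds because
  \<open>S\<close> and its symmetric part have the same quadratic form. With these identities
  \<open>second_order S\<close> acts on functions of \<open>z \<bullet> (A *v z)\<close> as the
  Laplacian acts on radial functions.\<close>

locale elliptic_cutoff =
  fixes S A :: "real^'n^'n" and m :: real and F :: "nat \<Rightarrow> real \<Rightarrow> real"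
  assumes F_deriv: "\<And>k s. (F k has_real_derivative F (Suc k) s) (at s)"
    and F_eq_0: "\<And>k s. 1 \<le> s \<Longrightarrow> F k s = 0"
    and F_pos: "\<And>s. s < 1 \<Longrightarrow> 0 < F 1 s"
    and A_sym: "\<And>x y. (A *v x) \<bullet> y = x \<bullet> (A *v y)"
    and trace_SA: "(\<Sum>k\<in>UNIV. \<Sum>j\<in>UNIV. S $ k $ j * A $ j $ k) = real CARD('n)"
    and ASA: "\<And>z. (A *v z) \<bullet> (S *v (A *v z)) = z \<bullet> (A *v z)"
    and m_pos: "0 < m"
    and coercive: "\<And>z. m * (norm z)\<^sup>2 \<le> z \<bullet> (A *v z)"
begin

text \<open>The index \<open>k\<close> counts derivatives of the profile: \<open>kern 0\<close>
  serves as test function, \<open>kern 1\<close> as mollifier around \<open>x\<close> at length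
  scale \<open>1 / \<tau>\<close>, and \<open>kern 2\<close> occurs in the derivatives.\<close>

definition kern :: "nat \<Rightarrow> real \<Rightarrow> real^'n \<Rightarrow> real^'n \<Rightarrow> real" where
  "kern k \<tau> x y = F k (\<tau>\<^sup>2 * ((y - x) \<bullet> (A *v (y - x))))"

lemma F_continuous: "continuous_on T (F k)"
  using F_deriv by (auto intro!: continuous_at_imp_continuous_on DERIV_isCont)

lemma A_continuous [continuous_intros]: "continuous_on T g \<Longrightarrow> continuous_on T (\<lambda>x. A *v g x)"
  by (rule bounded_linear.continuous_on[OF matrix_vector_mul_bounded_linear])

lemma kern_continuous [continuous_intros]:
  assumes "continuous_on T f" "continuous_on T g" "continuous_on T h"
  shows "continuous_on T (\<lambda>z. kern k (f z) (g z) (h z))"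
  unfolding kern_def
  by (rule continuous_on_compose2[OF F_continuous[of UNIV]]) (auto intro!: continuous_intros assms)

lemma kern_nonneg: "0 \<le> kern 1 \<tau> x y"
  unfolding kern_def using F_eq_0 F_pos by (metis linorder_le_cases linorder_not_less order.order_iff_strict)

text \<open>Coercivity pushes the argument of \<open>F k\<close> to 1 or beyond. The condition on
  \<open>\<tau>\<close>, \<open>m\<close> and \<open>r\<close>, which recurs below, thus says that
  the kernel lives in the ball of radius \<open>r\<close> about \<open>x\<close>.\<close>

lemma kern_eq_0:
  assumes "0 < r" and "1 \<le> \<tau>\<^sup>2 * m * r\<^sup>2" and "r \<le> norm (y - x)"
  shows "kern k \<tau> x y = 0"
proof -
  have "r\<^sup>2 \<le> (norm (y - x))\<^sup>2"
    using assms by (intro power_mono) auto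
  then have "m * r\<^sup>2 \<le> m * (norm (y - x))\<^sup>2"
    using m_pos by simp
  then have "m * r\<^sup>2 \<le> (y - x) \<bullet> (A *v (y - x))"
    using coercive[of "y - x"] by linarith
  then have "\<tau>\<^sup>2 * (m * r\<^sup>2) \<le> \<tau>\<^sup>2 * ((y - x) \<bullet> (A *v (y - x)))"
    by (rule mult_left_mono) simp
  then show ?thesis
    unfolding kern_def using assms(2) by (intro F_eq_0) (simp add: mult.assoc)
qed

lemma quad_has_derivative:
  "((\<lambda>y. (y - x) \<bullet> (A *v (y - x))) has_derivative (\<lambda>h. 2 * ((A *v (y - x)) \<bullet> h))) (at y)"
proof -
  have "((\<lambda>y. (y - x) \<bullet> (A *v (y - x))) has_derivative
      (\<lambda>h. (y - x) \<bullet> (A *v h) + h \<bullet> (A *v (y - x)))) (at y)"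
    by (auto intro!: derivative_eq_intros bounded_linear.has_derivative[OF matrix_vector_mul_bounded_linear])
  moreover have "(y - x) \<bullet> (A *v h) = (A *v (y - x)) \<bullet> h" for h
    by (simp only: A_sym)
  moreover have "h \<bullet> (A *v (y - x)) = (A *v (y - x)) \<bullet> h" for h
    by (rule inner_commute)
  ultimately show ?thesis
    by simp
qed

lemma kern_has_derivative:
  "(kern k \<tau> x has_derivative (\<lambda>h. kern (Suc k) \<tau> x y * (2 * \<tau>\<^sup>2 * ((A *v (y - x)) \<bullet> h)))) (at y)"
proof -
  have "((\<lambda>y. \<tau>\<^sup>2 * ((y - x) \<bullet> (A *v (y - x)))) has_derivative
      (\<lambda>h. \<tau>\<^sup>2 * (2 * ((A *v (y - x)) \<bullet> h)))) (at y)"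
    by (intro has_derivative_mult_right quad_has_derivative)
  note * = has_derivative_compose[OF this
      F_deriv[of k "\<tau>\<^sup>2 * ((y - x) \<bullet> (A *v (y - x)))", unfolded has_field_derivative_def]]
  have eq: "kern k \<tau> x = (\<lambda>y. F k (\<tau>\<^sup>2 * ((y - x) \<bullet> (A *v (y - x)))))"
    by (intro ext) (rule kern_def)
  show ?thesis
    unfolding eq by (rule has_derivative_eq_rhs[OF *]) (simp add: kern_def fun_eq_iff)
qed

text \<open>The quadratic form is even. This later turns the derivative in \<open>y\<close> into one
  in the centre \<open>x\<close>.\<close>

lemma kern_sym: "kern k \<tau> x y = kern k \<tau> y x"
proof -
  have "(y - x) \<bullet> (A *v (y - x)) = (x - y) \<bullet> (A *v (x - y))"
    by (simp add: matrix_vector_mult_diff_distrib inner_diff_left inner_diff_right)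
  then show ?thesis
    by (simp add: kern_def)
qed

text \<open>The bracket is kept in exactly the shape in which \<open>second_order_kern\<close>
  produces it.\<close>

lemma kern_has_derivative_scale:
  "((\<lambda>\<tau>. \<tau> ^ CARD('n) * kern 1 \<tau> x y) has_real_derivative
     \<tau> ^ (CARD('n) - 1) * (real CARD('n) * kern 1 \<tau> x y
       + 2 * (\<tau>\<^sup>2 * ((y - x) \<bullet> (A *v (y - x)))) * kern 2 \<tau> x y)) (at \<tau> within U)"
proof -
  define q where "q = (y - x) \<bullet> (A *v (y - x))"
  have "((\<lambda>\<tau>. \<tau>\<^sup>2 * q) has_real_derivative 2 * \<tau> * q) (at \<tau> within U)"
    by (auto intro!: derivative_eq_intros)
  from DERIV_chain2[OF F_deriv this]
  have *: "((\<lambda>\<tau>. F 1 (\<tau>\<^sup>2 * q)) has_real_derivative F 2 (\<tau>\<^sup>2 * q) * (2 * \<tau> * q)) (at \<tau> within U)"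
    by (simp add: numeral_2_eq_2)
  \<comment> \<open>The dimension is at least 1, so the truncated subtraction in the exponent is a
    genuine one.\<close>
  have p: "\<tau> ^ CARD('n) = \<tau> ^ (CARD('n) - 1) * \<tau>"
    by (metis power_minus_mult zero_less_card_finite)
  show ?thesis
    unfolding kern_def q_def[symmetric]
    by (rule DERIV_cong[OF DERIV_mult[OF DERIV_pow *]]) (simp add: p algebra_simps power2_eq_square)
qed

text \<open>With \<open>w = A *v (y - x)\<close> the second derivatives are
  \<open>2 \<tau>^2 A_jk\<close> times \<open>kern 1\<close> plus \<open>4 \<tau>^4 w_k w_j\<close>
  times \<open>kern 2\<close>. In the contraction with \<open>S\<close>, \<open>trace_SA\<close>
  turns the first coefficient into the dimension and \<open>ASA\<close> the second into the
  quadratic form.\<close>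

lemma second_order_kern:
  "second_order S (kern 0 \<tau> x) y = 2 * \<tau>\<^sup>2 * (real CARD('n) * kern 1 \<tau> x y
     + 2 * (\<tau>\<^sup>2 * ((y - x) \<bullet> (A *v (y - x)))) * kern 2 \<tau> x y)"
proof -
  define w where "w = A *v (y - x)"
  have d1: "(\<lambda>z. frechet_derivative (kern 0 \<tau> x) (at z) (axis j 1)) =
      (\<lambda>z. kern 1 \<tau> x z * (2 * \<tau>\<^sup>2 * (A *v (z - x)) $ j))" for j
    by (simp add: frechet_derivative_at[OF kern_has_derivative, symmetric] inner_axis)
  have "((\<lambda>z. kern 1 \<tau> x z * (2 * \<tau>\<^sup>2 * (A *v (z - x)) $ j)) has_derivative
      (\<lambda>h. kern 1 \<tau> x y * (2 * \<tau>\<^sup>2 * (A *v h) $ j)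
        + kern 2 \<tau> x y * (2 * \<tau>\<^sup>2 * (w \<bullet> h)) * (2 * \<tau>\<^sup>2 * w $ j))) (at y)" for j
  proof -
    have "((\<lambda>z. 2 * \<tau>\<^sup>2 * (A *v (z - x)) $ j) has_derivative (\<lambda>h. 2 * \<tau>\<^sup>2 * (A *v h) $ j)) (at y)"
      by (auto intro!: derivative_eq_intros bounded_linear.has_derivative[OF bounded_linear_vec_nth]
          bounded_linear.has_derivative[OF matrix_vector_mul_bounded_linear])
    from has_derivative_mult[OF kern_has_derivative[of 1] this] show ?thesis
      by (simp add: w_def numeral_2_eq_2)
  qed
  from frechet_derivative_at[OF this, symmetric]
  have "second_order S (kern 0 \<tau> x) y = (\<Sum>k\<in>UNIV. \<Sum>j\<in>UNIV. S $ k $ j *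
      (kern 1 \<tau> x y * (2 * \<tau>\<^sup>2 * A $ j $ k) + kern 2 \<tau> x y * (2 * \<tau>\<^sup>2 * w $ k) * (2 * \<tau>\<^sup>2 * w $ j)))"
    unfolding second_order_def d1 by (simp add: inner_axis matrix_vector_mult_basis column_def)
  also have "\<dots> = 2 * \<tau>\<^sup>2 * kern 1 \<tau> x y * (\<Sum>k\<in>UNIV. \<Sum>j\<in>UNIV. S $ k $ j * A $ j $ k)
      + 4 * \<tau>\<^sup>2 * \<tau>\<^sup>2 * kern 2 \<tau> x y * (\<Sum>k\<in>UNIV. \<Sum>j\<in>UNIV. S $ k $ j * w $ k * w $ j)"
    by (simp add: sum_distrib_left sum.distrib[symmetric] algebra_simps)
  also have "(\<Sum>k\<in>UNIV. \<Sum>j\<in>UNIV. S $ k $ j * w $ k * w $ j) = w \<bullet> (S *v w)"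
    by (simp add: inner_vec_def matrix_vector_mult_def sum_distrib_left mult_ac)
  also have "\<dots> = (y - x) \<bullet> (A *v (y - x))"
    unfolding w_def by (rule ASA)
  finally show ?thesis
    unfolding trace_SA by (simp add: algebra_simps)
qed

lemma kern_test_function:
  assumes "0 < r" and "1 \<le> \<tau>\<^sup>2 * m * r\<^sup>2" and "cball x r \<subseteq> \<Omega>"
  shows "kern 0 \<tau> x \<in> test_functions \<Omega>"
proof (rule test_functionsI[OF _ compact_cball assms(3)])
  have lin: "Ck_on k UNIV (\<lambda>y::real^'n. (M *v (y - c)) $ i)" for k c i and M :: "real^'n^'n"
  proof -
    have "Ck_on k UNIV (\<lambda>y. (M *v y) $ i + - (M *v c) $ i)"
      by (intro Ck_on_add Ck_on_const Ck_on_bounded_linear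
          bounded_linear_compose[OF bounded_linear_vec_nth matrix_vector_mul_bounded_linear])
    then show ?thesis
      by (simp add: matrix_vector_mult_diff_distrib)
  qed
  have sum: "Ck_on k UNIV (\<lambda>y::real^'n. \<Sum>i\<in>I. g i y)"
    if "\<And>i. Ck_on k UNIV (g i)" for k and g :: "'i \<Rightarrow> real^'n \<Rightarrow> real" and I
    by (induction I rule: infinite_finite_induct) (auto intro!: Ck_on_const Ck_on_add that)
  \<comment> \<open>\<open>mat 1\<close> is inserted so that \<open>lin\<close> covers both factors
    of each product.\<close>
  have "Ck_on k UNIV (\<lambda>y. \<tau>\<^sup>2 * (\<Sum>i\<in>UNIV. (mat 1 *v (y - x)) $ i * (A *v (y - x)) $ i))" for k
    by (intro Ck_on_mult Ck_on_const sum lin)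
  then have "Ck_on k UNIV (\<lambda>y. \<tau>\<^sup>2 * ((y - x) \<bullet> (A *v (y - x))))" for k
    by (simp add: inner_vec_def)
  then show "Ck_on k UNIV (kern 0 \<tau> x)" for k
    unfolding kern_def by (rule Ck_on_compose_real[where F = F, OF F_deriv])
  show "kern 0 \<tau> x y = 0" if "y \<notin> cball x r" for y
    using kern_eq_0[OF assms(1,2), of y x] that by (simp add: dist_norm norm_minus_commute)
qed

section \<open>Mollification of weak solutions\<close>

text \<open>Differentiation in the scale \<open>t\<close> under the integral yields a power of
  \<open>t\<close> times the integral of \<open>v y * G t y\<close>, and the weak equation tested
  with \<open>kern 0 t x\<close> says that this integral vanishes.\<close>

lemma mollification_const:
  assumes weak: "\<And>\<psi>. \<psi> \<in> test_functions \<Omega> \<Longrightarrow> (LINT y:\<Omega>|lebesgue. v y * second_order S \<psi> y) = 0"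
    and cont: "continuous_on (cbox a b) v" and sub: "cbox a b \<subseteq> \<Omega>"
    and r: "0 < r" "cball x r \<subseteq> cbox a b"
    and \<sigma>: "0 < \<sigma>" "1 \<le> \<sigma>\<^sup>2 * m * r\<^sup>2" and "\<sigma> \<le> \<tau>"
  shows "integral (cbox a b) (\<lambda>y. v y * (\<tau> ^ CARD('n) * kern 1 \<tau> x y)) =
    integral (cbox a b) (\<lambda>y. v y * (\<sigma> ^ CARD('n) * kern 1 \<sigma> x y))"
proof -
  define G where "G t y = real CARD('n) * kern 1 t x y
    + 2 * (t\<^sup>2 * ((y - x) \<bullet> (A *v (y - x)))) * kern 2 t x y" for t y
  define M where "M t = integral (cbox a b) (\<lambda>y. v y * (t ^ CARD('n) * kern 1 t x y))" for t
  have G_cont: "continuous_on (T \<times> cbox a b) (\<lambda>(t, y). v y * (t ^ (CARD('n) - 1) * G t y))" for T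
    unfolding G_def case_prod_beta
    by (intro continuous_intros continuous_on_compose2[OF cont]) auto
  have "(M has_real_derivative 0) (at t within {\<sigma>..})" if t: "t \<in> {\<sigma>..}" for t
  proof -
    \<comment> \<open>Raising the scale shrinks the support, so \<open>kern 0 t x\<close> is an
      admissible test function for every \<open>t \<ge> \<sigma>\<close>.\<close>
    have big: "1 \<le> t\<^sup>2 * m * r\<^sup>2"
    proof -
      have "\<sigma>\<^sup>2 * (m * r\<^sup>2) \<le> t\<^sup>2 * (m * r\<^sup>2)"
        using t \<sigma>(1) m_pos by (intro mult_right_mono power_mono) auto
      with \<sigma>(2) show ?thesis
        by (simp add: mult.assoc)
    qed
    have zero: "G t y = 0" if "y \<notin> cbox a b" for y
      using that r kern_eq_0[OF r(1) big, of y x] unfolding G_def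
      by (auto simp: subset_eq dist_norm norm_minus_commute)
    have "integral (cbox a b) (\<lambda>y. v y * (2 * t\<^sup>2 * G t y)) = (LINT y:\<Omega>|lebesgue. v y * (2 * t\<^sup>2 * G t y))"
    proof (rule set_lebesgue_integral_eq_integral_cbox[OF _ sub, symmetric])
      show "continuous_on (cbox a b) (\<lambda>y. v y * (2 * t\<^sup>2 * G t y))"
        unfolding G_def by (intro continuous_intros cont)
    qed (use zero in auto)
    also have "\<dots> = 0"
      using weak[OF kern_test_function[OF r(1) big]] r(2) sub
      by (simp add: second_order_kern G_def)
    finally have "integral (cbox a b) (\<lambda>y. (2 * t\<^sup>2) * (v y * G t y)) = 0"
      by (simp add: mult_ac)
    then have "integral (cbox a b) (\<lambda>y. v y * G t y) = 0"
      using t \<sigma>(1) by (simp add: integral_mult_right)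
    then have "integral (cbox a b) (\<lambda>y. t ^ (CARD('n) - 1) * (v y * G t y)) = 0"
      by (simp add: integral_mult_right)
    moreover have "(M has_real_derivative
        integral (cbox a b) (\<lambda>y. v y * (t ^ (CARD('n) - 1) * G t y))) (at t within {\<sigma>..})"
      unfolding M_def
    proof (rule leibniz_rule_field_derivative[OF _ _ G_cont t])
      show "((\<lambda>t. v y * (t ^ CARD('n) * kern 1 t x y)) has_real_derivative
          v y * (t ^ (CARD('n) - 1) * G t y)) (at t within {\<sigma>..})" for t y
        unfolding G_def by (intro DERIV_cmult kern_has_derivative_scale)
      show "(\<lambda>y. v y * (t ^ CARD('n) * kern 1 t x y)) integrable_on cbox a b" for t
        by (intro integrable_continuous continuous_intros cont)
    qed simp
    ultimately show ?thesis
      by (simp add: mult_ac)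
  qed
  then have "\<exists>c. \<forall>t\<in>{\<sigma>..}. M t = c"
    by (intro has_field_derivative_zero_constant) auto
  with \<open>\<sigma> \<le> \<tau>\<close> show ?thesis
    unfolding M_def by force
qed

text \<open>The substitution \<open>z = \<tau> (y - x)\<close>, whose Jacobian is the factor
  \<open>\<tau> ^ CARD('n)\<close>, reduces every kernel to the one with scale 1 and centre 0; hence
  one constant serves all scales and centres.\<close>

lemma kern_mass:
  obtains c where "0 < c"
    and "\<And>x r \<tau> a b. \<lbrakk>0 < r; 0 < \<tau>; 1 \<le> \<tau>\<^sup>2 * m * r\<^sup>2; cball x r \<subseteq> cbox a b\<rbrakk> \<Longrightarrow>
      ((\<lambda>y. \<tau> ^ CARD('n) * kern 1 \<tau> x y) has_integral c) (cbox a b)"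
proof
  define f where "f = kern 1 1 0"
  define c where "c = integral UNIV f"
  \<comment> \<open>Chosen so that \<open>m * R^2 = 1\<close>: the unit-scale kernel vanishes
    outside the ball of radius \<open>R\<close>.\<close>
  define R where "R = 1 / sqrt m"
  have R: "0 < R" "1 \<le> 1\<^sup>2 * m * R\<^sup>2"
    using m_pos by (auto simp: R_def power_divide)
  have f_cont: "continuous_on T f" for T
    unfolding f_def by (intro continuous_intros)
  have f_zero: "f z = 0" if "R \<le> norm z" for z
    unfolding f_def by (rule kern_eq_0[OF R]) (use that in simp)
  have c_eq: "(f has_integral c) (cbox a b)" if sub: "\<And>z. norm z < R \<Longrightarrow> z \<in> cbox a b" for a b
  proof -
    have *: "(f has_integral integral (cbox a b) f) (cbox a b)"
      by (intro integrable_integral integrable_continuous f_cont)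
    have "f z = 0" if "z \<notin> cbox a b" for z
      using that sub f_zero by (metis not_less)
    then have "(f has_integral integral (cbox a b) f) UNIV"
      by (intro has_integral_on_superset[OF *]) auto
    then have "c = integral (cbox a b) f"
      unfolding c_def by (rule integral_unique)
    with * show ?thesis
      by (simp only:)
  qed
  obtain e where e: "ball 0 R \<subseteq> cbox (- e) (e::real^'n)"
    using bounded_subset_cbox_symmetric[OF bounded_ball] by blast
  have int: "(f has_integral c) (cbox (- e) e)"
    by (rule c_eq) (use e in auto)
  have nonneg: "0 \<le> f z" for z
    unfolding f_def by (rule kern_nonneg)
  \<comment> \<open>A continuous nonnegative function with zero integral over the box would vanish
    at 0, where \<open>F 1 0\<close> is positive.\<close>
  have "c \<noteq> 0"
  proof
    assume "c = 0"
    have "0 \<in> interior (cbox (- e) e)"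
      using e R(1) by (meson centre_in_ball interior_maximal open_ball subsetD)
    then have ne: "0 \<in> box (- e) e"
      by simp
    then have "f 0 = 0"
      using has_integral_0_cbox_imp_0[OF f_cont nonneg, of "- e" e 0] int \<open>c = 0\<close> box_subset_cbox by blast
    moreover have "0 < f 0"
      using F_pos[of 0] by (simp add: f_def kern_def)
    ultimately show False by simp
  qed
  moreover have "0 \<le> c"
    using has_integral_nonneg[OF int] nonneg by auto
  ultimately show "0 < c" by simp
  fix x :: "real^'n" and r \<tau> :: real and a b
  assume r: "0 < r" and \<tau>: "0 < \<tau>" and big: "1 \<le> \<tau>\<^sup>2 * m * r\<^sup>2" and sub: "cball x r \<subseteq> cbox a b"
  have scale: "f (\<tau> *\<^sub>R y + - \<tau> *\<^sub>R x) = kern 1 \<tau> x y" for y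
  proof -
    have "\<tau> *\<^sub>R y + - \<tau> *\<^sub>R x = \<tau> *\<^sub>R (y - x)"
      by (simp add: algebra_simps)
    then show ?thesis
      by (simp add: f_def kern_def matrix_vector_mult_scaleR power2_eq_square mult_ac)
  qed
  \<comment> \<open>The condition on \<open>\<tau>\<close> amounts to
    \<open>R \<le> \<tau> * r\<close>, so the rescaled box contains the whole support of
    \<open>f\<close> and captures its full mass.\<close>
  have "z \<in> cbox (\<tau> *\<^sub>R a + - \<tau> *\<^sub>R x) (\<tau> *\<^sub>R b + - \<tau> *\<^sub>R x)" if "norm z < R" for z
  proof -
    have "1 / \<tau>\<^sup>2 \<le> m * r\<^sup>2"
      using big \<tau> by (simp add: field_simps)
    then have "R\<^sup>2 \<le> (\<tau> * r)\<^sup>2"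
      using \<tau> m_pos by (simp add: R_def power_divide field_simps)
    then have "R \<le> \<tau> * r"
      by (rule power2_le_imp_le) (use r \<tau> in simp)
    then have "norm (z /\<^sub>R \<tau>) \<le> r"
      using that \<tau> by (simp add: field_simps)
    then have "x + z /\<^sub>R \<tau> \<in> cbox a b"
      by (intro subsetD[OF sub]) (simp add: dist_norm)
    then have "\<tau> * a $ i \<le> \<tau> * (x $ i + z $ i / \<tau>)" "\<tau> * (x $ i + z $ i / \<tau>) \<le> \<tau> * b $ i" for i
      using \<tau> by (auto simp: mem_box_cart divide_inverse mult.commute)
    with \<tau> show ?thesis
      by (simp add: mem_box_cart algebra_simps)
  qed
  from has_integral_affinity'[OF c_eq[OF this] \<tau>, of "- \<tau> *\<^sub>R x"]
  have "((\<lambda>y. kern 1 \<tau> x y) has_integral (c /\<^sub>R \<tau> ^ CARD('n))) (cbox a b)"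
    using \<tau> unfolding scale by simp
  from has_integral_mult_right[OF this, of "\<tau> ^ CARD('n)"]
  show "((\<lambda>y. \<tau> ^ CARD('n) * kern 1 \<tau> x y) has_integral c) (cbox a b)"
    using \<tau> by (simp add: mult.assoc[symmetric])
qed

text \<open>The kernels form an approximate identity of mass \<open>c\<close>, so the mollifications
  tend to \<open>v x * c\<close> as the scale grows; since they do not depend on the scale, the
  value at \<open>\<sigma>\<close> already equals the limit. The mass is a parameter so that the
  caller can use the same \<open>c\<close> for all centres.\<close>

lemma mollification_eq:
  assumes weak: "\<And>\<psi>. \<psi> \<in> test_functions \<Omega> \<Longrightarrow> (LINT y:\<Omega>|lebesgue. v y * second_order S \<psi> y) = 0"
    and cont: "continuous_on (cbox a b) v" and sub: "cbox a b \<subseteq> \<Omega>"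
    and r: "0 < r" "cball x r \<subseteq> cbox a b"
    and \<sigma>: "0 < \<sigma>" "1 \<le> \<sigma>\<^sup>2 * m * r\<^sup>2"
    and c: "0 < c" "\<And>\<tau>. \<lbrakk>0 < \<tau>; 1 \<le> \<tau>\<^sup>2 * m * r\<^sup>2\<rbrakk> \<Longrightarrow>
      ((\<lambda>y. \<tau> ^ CARD('n) * kern 1 \<tau> x y) has_integral c) (cbox a b)"
  shows "integral (cbox a b) (\<lambda>y. v y * (\<sigma> ^ CARD('n) * kern 1 \<sigma> x y)) = v x * c"
proof -
  define I where "I \<tau> = integral (cbox a b) (\<lambda>y. v y * (\<tau> ^ CARD('n) * kern 1 \<tau> x y))" for \<tau>
  have "\<bar>I \<sigma> - v x * c\<bar> \<le> 0 + \<epsilon>" if "0 < \<epsilon>" for \<epsilon>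
  proof -
    have "x \<in> cbox a b"
      using r by (meson centre_in_cball less_imp_le subsetD)
    moreover have "0 < \<epsilon> / c"
      using that c(1) by simp
    ultimately obtain \<delta> where \<delta>: "0 < \<delta>"
      "\<And>y. y \<in> cbox a b \<Longrightarrow> dist y x < \<delta> \<Longrightarrow> dist (v y) (v x) < \<epsilon> / c"
      using cont unfolding continuous_on_iff by metis
    \<comment> \<open>The first bound keeps \<open>mollification_const\<close> applicable, the
      second confines the kernel to the ball of radius \<open>\<delta>\<close> given by
      continuity.\<close>
    define \<tau> where "\<tau> = max \<sigma> (1 / (\<delta> * sqrt m))"
    have \<tau>: "\<sigma> \<le> \<tau>" "0 < \<tau>"
      using \<sigma> by (auto simp: \<tau>_def)
    have big: "1 \<le> \<tau>\<^sup>2 * m * \<delta>\<^sup>2"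
    proof -
      have "(1 / (\<delta> * sqrt m))\<^sup>2 \<le> \<tau>\<^sup>2"
        using \<delta>(1) m_pos by (intro power_mono) (auto simp: \<tau>_def)
      then have "1 / (\<delta>\<^sup>2 * m) \<le> \<tau>\<^sup>2"
        using m_pos by (simp add: power_divide power_mult_distrib)
      with \<delta>(1) m_pos show ?thesis
        by (simp add: field_simps)
    qed
    have "1 \<le> \<tau>\<^sup>2 * m * r\<^sup>2"
    proof -
      have "\<sigma>\<^sup>2 * (m * r\<^sup>2) \<le> \<tau>\<^sup>2 * (m * r\<^sup>2)"
        using \<tau> \<sigma>(1) m_pos by (intro mult_right_mono power_mono) auto
      with \<sigma>(2) show ?thesis
        by (simp add: mult.assoc)
    qed
    note mass = c(2)[OF \<tau>(2) this]
    define k where "k y = \<tau> ^ CARD('n) * kern 1 \<tau> x y" for y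
    have k_cont: "continuous_on (cbox a b) k"
      unfolding k_def by (intro continuous_intros)
    have mass: "(k has_integral c) (cbox a b)"
      using mass unfolding k_def .
    have "I \<tau> - v x * c = integral (cbox a b) (\<lambda>y. v y * k y) - integral (cbox a b) (\<lambda>y. v x * k y)"
      using integral_unique[OF mass] by (simp only: I_def k_def[symmetric] integral_mult_right)
    also have "\<dots> = integral (cbox a b) (\<lambda>y. v y * k y - v x * k y)"
      by (intro Henstock_Kurzweil_Integration.integral_diff[symmetric] integrable_continuous
          continuous_intros cont k_cont)
    \<comment> \<open>Within distance \<open>\<delta>\<close> of \<open>x\<close> the oscillation of
      \<open>v\<close> is below \<open>\<epsilon> / c\<close>; farther away the kernel
      vanishes.\<close>
    also have "norm \<dots> \<le> integral (cbox a b) (\<lambda>y. \<epsilon> / c * k y)"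
    proof (rule Henstock_Kurzweil_Integration.integral_norm_bound_integral)
      show "norm (v y * k y - v x * k y) \<le> \<epsilon> / c * k y" if "y \<in> cbox a b" for y
      proof (cases "dist y x < \<delta>")
        case True
        have "0 \<le> k y"
          using \<tau>(2) kern_nonneg by (simp add: k_def)
        moreover have "\<bar>v y - v x\<bar> \<le> \<epsilon> / c"
          using \<delta>(2)[OF that True] by (simp add: dist_real_def)
        ultimately have "\<bar>v y - v x\<bar> * k y \<le> \<epsilon> / c * k y"
          by (rule mult_right_mono[rotated])
        then show ?thesis
          using \<open>0 \<le> k y\<close> by (simp add: left_diff_distrib[symmetric] abs_mult)
      next
        case False
        then show ?thesis
          using kern_eq_0[OF \<delta>(1) big, of y x] by (simp add: k_def dist_norm)
      qed
    qed (intro integrable_continuous continuous_intros cont k_cont)+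
    also have "\<dots> = \<epsilon>"
      using integral_unique[OF mass] c(1) by (simp add: integral_mult_right)
    finally have "\<bar>I \<tau> - v x * c\<bar> \<le> \<epsilon>"
      by simp
    moreover have "I \<tau> = I \<sigma>"
      unfolding I_def by (rule mollification_const[OF weak cont sub r \<sigma> \<tau>(1)])
    ultimately show ?thesis
      by simp
  qed
  then have "\<bar>I \<sigma> - v x * c\<bar> \<le> 0"
    by (rule field_le_epsilon)
  then show ?thesis
    by (simp add: I_def)
qed

section \<open>Local regularity of scalar weak solutions\<close>

text \<open>Near \<open>x0\<close> the function \<open>v\<close> is \<open>1 / c\<close> times its
  mollification at one fixed scale, and there all dependence on \<open>x\<close> sits in the smooth
  kernel.\<close>

lemma weak_solution_locally_C1:
  assumes weak: "\<And>\<psi>. \<psi> \<in> test_functions \<Omega> \<Longrightarrow> (LINT y:\<Omega>|lebesgue. v y * second_order S \<psi> y) = 0"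
    and cont: "continuous_on \<Omega> v" and "open \<Omega>" and "x0 \<in> \<Omega>"
  obtains r D where "0 < r" "continuous_on (ball x0 r) D"
    and "\<And>x. x \<in> ball x0 r \<Longrightarrow> (v has_derivative blinfun_apply (D x)) (at x)"
proof -
  obtain a b where ab: "x0 \<in> box a b" "cbox a b \<subseteq> \<Omega>"
    using open_contains_cbox[OF assms(3,4)] by metis
  obtain s where s: "0 < s" "ball x0 s \<subseteq> box a b"
    using ab(1) open_box by (metis open_contains_ball)
  \<comment> \<open>Half the radius leaves room for a closed ball of radius \<open>r\<close> around
    every centre in \<open>ball x0 r\<close>, so a single scale works for all of them.\<close>
  define r where "r = s / 2"
  have r: "0 < r"
    using s by (simp add: r_def)
  have sub: "cball x r \<subseteq> cbox a b" if "x \<in> ball x0 r" for x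
  proof -
    have "cball x r \<subseteq> ball x0 s"
    proof
      fix y assume "y \<in> cball x r"
      with that dist_triangle[of x0 y x] show "y \<in> ball x0 s"
        by (simp add: r_def)
    qed
    with s(2) box_subset_cbox show ?thesis by blast
  qed
  define \<sigma> where "\<sigma> = 1 / (r * sqrt m)"
  have \<sigma>: "0 < \<sigma>" "1 \<le> \<sigma>\<^sup>2 * m * r\<^sup>2"
    using r m_pos by (auto simp: \<sigma>_def power_divide power_mult_distrib)
  obtain c where c: "0 < c"
    and mass: "\<And>x r \<tau> a b. \<lbrakk>0 < r; 0 < \<tau>; 1 \<le> \<tau>\<^sup>2 * m * r\<^sup>2; cball x r \<subseteq> cbox a b\<rbrakk> \<Longrightarrow>
      ((\<lambda>y. \<tau> ^ CARD('n) * kern 1 \<tau> x y) has_integral c) (cbox a b)"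
    using kern_mass by blast
  have cont_ab: "continuous_on (cbox a b) v"
    using cont ab(2) continuous_on_subset by blast
  define P where "P x = integral (cbox a b) (\<lambda>y. v y * (\<sigma> ^ CARD('n) * kern 1 \<sigma> x y))" for x
  have P: "P x = v x * c" if "x \<in> ball x0 r" for x
    unfolding P_def
    by (rule mollification_eq[OF weak cont_ab ab(2) r sub[OF that] \<sigma> c])
       (use mass r sub[OF that] in auto)
  \<comment> \<open>The derivative of the integrand in the centre \<open>x\<close>, packed as a
    bounded linear functional as \<open>leibniz_rule\<close> demands; by \<open>kern_sym\<close> the
    vector is \<open>x - y\<close>.\<close>
  define E where "E x y = (v y * (\<sigma> ^ CARD('n) * (kern 2 \<sigma> x y * (2 * \<sigma>\<^sup>2)))) *\<^sub>R
      blinfun_inner_right (A *v (x - y))" for x y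
  have E_cont: "continuous_on (ball x0 r \<times> cbox a b) (\<lambda>(x, y). E x y)"
    unfolding E_def case_prod_beta
    by (intro continuous_intros continuous_on_compose2[OF cont_ab]
        bounded_linear.continuous_on[OF bounded_linear_blinfun_inner_right]) auto
  have P_deriv: "(P has_derivative integral (cbox a b) (E x)) (at x)" if x: "x \<in> ball x0 r" for x
  proof -
    have "(P has_derivative integral (cbox a b) (E x)) (at x within ball x0 r)"
      unfolding P_def
    proof (rule leibniz_rule[OF _ _ E_cont x convex_ball])
      fix z y
      have "(\<lambda>z. kern 1 \<sigma> z y) = kern 1 \<sigma> y"
        by (intro ext) (rule kern_sym)
      then have "((\<lambda>z. kern 1 \<sigma> z y) has_derivative
          (\<lambda>h. kern 2 \<sigma> z y * (2 * \<sigma>\<^sup>2 * ((A *v (z - y)) \<bullet> h)))) (at z within ball x0 r)"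
        using has_derivative_at_withinI[OF kern_has_derivative[of 1 \<sigma> y z]] kern_sym[of 2 \<sigma> z y]
        by (simp add: numeral_2_eq_2)
      from has_derivative_mult_right[OF has_derivative_mult_right[OF this]]
      show "((\<lambda>z. v y * (\<sigma> ^ CARD('n) * kern 1 \<sigma> z y)) has_derivative blinfun_apply (E z y))
          (at z within ball x0 r)"
        by (rule has_derivative_eq_rhs) (simp add: E_def fun_eq_iff scaleR_blinfun.rep_eq)
      show "(\<lambda>y. v y * (\<sigma> ^ CARD('n) * kern 1 \<sigma> z y)) integrable_on cbox a b"
        by (intro integrable_continuous continuous_intros cont_ab)
    qed
    then show ?thesis
      using at_within_open[OF x open_ball] by simp
  qed
  show thesis
  proof
    show "continuous_on (ball x0 r) (\<lambda>x. (1 / c) *\<^sub>R integral (cbox a b) (E x))"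
      by (intro continuous_intros integral_continuous_on_param E_cont)
    fix x assume x: "x \<in> ball x0 r"
    have "((\<lambda>x. (1 / c) *\<^sub>R P x) has_derivative
        blinfun_apply ((1 / c) *\<^sub>R integral (cbox a b) (E x))) (at x)"
      using has_derivative_scaleR_right[OF P_deriv[OF x], of "1 / c"]
      by (simp add: scaleR_blinfun.rep_eq)
    then show "(v has_derivative blinfun_apply ((1 / c) *\<^sub>R integral (cbox a b) (E x))) (at x)"
      by (rule has_derivative_transform_within_open[OF _ open_ball x]) (use P c in auto)
  qed (rule r)
qed

end

subsection \<open>The gradient of the energy on the orthogonal group\<close>

text \<open>The Riesz representative of a derivative \<open>W'\<close> is its adjoint applied to
  1.\<close>

lemma GDERIV_gradient:
  fixes W :: "'a::euclidean_space \<Rightarrow> real"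
  assumes "W differentiable (at X)"
  shows "GDERIV W X :> gradient W X"
proof -
  obtain W' where W': "(W has_derivative W') (at X)"
    using assms unfolding differentiable_def by blast
  have lin: "linear W'"
    using W' by (rule has_derivative_linear)
  have "W' h = h \<bullet> adjoint W' 1" for h
    using adjoint_works[OF lin, of h 1] by simp
  then have "W' = (\<lambda>h. h \<bullet> adjoint W' 1)"
    by (rule ext)
  with W' have "GDERIV W X :> adjoint W' 1"
    unfolding gderiv_def by metis
  then show ?thesis
    using gradient_eqI by metis
qed

lemma inner_matrix_mult_left:
  fixes M X Y :: "real^'n^'n"
  shows "inner (transpose M ** X) Y = inner X (M ** Y)"
  by (simp add: inner_matrix_eq_trace matrix_transpose_mul matrix_mul_assoc)

text \<open>\<open>W\<close> equals its composition with left multiplication by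
  \<open>transpose R\<close>, which sends \<open>R\<close> to the identity. Differentiating this at
  \<open>R\<close> and moving \<open>transpose R\<close> across the inner product gives the
  formula.\<close>

lemma gradient_frame_indifferent:
  fixes W :: "real^'n^'n \<Rightarrow> real"
  assumes W: "W differentiable (at (mat 1))" and "frame_indifferent W" and R: "orthogonal_matrix R"
  shows "gradient W R = R ** gradient W (mat 1)"
proof (rule gradient_eqI)
  have RR: "transpose R ** R = mat 1" and R': "orthogonal_matrix (transpose R)"
    using R by (simp_all add: orthogonal_matrix_def)
  have "bounded_linear (\<lambda>Y. transpose R ** Y)"
    by (auto intro!: linear_conv_bounded_linear[THEN iffD1] linearI
        simp: matrix_add_ldistrib matrix_scalar_ac[symmetric] scalar_matrix_assoc)
  then have "((\<lambda>Y. transpose R ** Y) has_derivative (\<lambda>h. transpose R ** h)) (at R)"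
    by (rule bounded_linear_imp_has_derivative)
  moreover have "(W has_derivative (\<lambda>h. inner h (gradient W (mat 1)))) (at (transpose R ** R))"
    using GDERIV_gradient[OF W] unfolding gderiv_def RR .
  ultimately have "((\<lambda>Y. W (transpose R ** Y)) has_derivative
      (\<lambda>h. inner (transpose R ** h) (gradient W (mat 1)))) (at R)"
    by (rule has_derivative_compose)
  then show "GDERIV W R :> R ** gradient W (mat 1)"
    using assms(2) R' by (simp add: gderiv_def frame_indifferent_def inner_matrix_mult_left)
qed

section \<open>Positivity of \<open>DW(I)\<close> by means of reflections\<close>

definition outer_square :: "real^'n \<Rightarrow> real^'n^'n" where
  "outer_square b = (\<chi> i j. b $ i * b $ j)"

lemma outer_square_mult: "outer_square b *v x = (b \<bullet> x) *\<^sub>R b"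
  by (simp add: vec_eq_iff outer_square_def matrix_vector_mult_def inner_vec_def sum_distrib_left mult_ac)

lemma rank_outer_square:
  assumes "b \<noteq> 0"
  shows "rank (outer_square b) = 1"
proof -
  have "range (\<lambda>x. outer_square b *v x) = span {b}"
  proof -
    have "t *\<^sub>R b \<in> range (\<lambda>x. (b \<bullet> x) *\<^sub>R b)" for t
      using assms by (intro range_eqI[where x = "(t / (b \<bullet> b)) *\<^sub>R b"]) simp
    then show ?thesis
      by (auto simp: outer_square_mult span_singleton)
  qed
  with assms show ?thesis
    by (simp add: rank_dim_range)
qed

text \<open>This is the Householder reflection along \<open>b\<close>; as \<open>b\<close> is not
  normalised, the factor 2 is divided by \<open>b \<bullet> b\<close>.\<close>

lemma orthogonal_matrix_reflection:
  assumes "b \<noteq> 0"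
  shows "orthogonal_matrix (mat 1 + (- (2 / (b \<bullet> b))) *\<^sub>R outer_square b)"
proof -
  define M where "M = mat 1 + (- (2 / (b \<bullet> b))) *\<^sub>R outer_square b"
  have M: "M *v x = x - (2 * (b \<bullet> x) / (b \<bullet> b)) *\<^sub>R b" for x
    by (simp add: M_def matrix_vector_mult_diff_rdistrib scaleR_matrix_vector_assoc[symmetric] outer_square_mult)
  have "(M *v x) \<bullet> (M *v x) = x \<bullet> x" for x
    using assms unfolding M
    by (simp add: inner_diff_left inner_diff_right inner_commute field_simps)
  then have "orthogonal_transformation (\<lambda>x. M *v x)"
    by (simp add: orthogonal_transformation norm_eq)
  then show ?thesis
    unfolding M_def by (simp add: orthogonal_transformation_matrix)
qed

lemma gradient_identity_positive:
  fixes W :: "real^'n^'n \<Rightarrow> real"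
  assumes W: "W differentiable (at (mat 1))" and fi: "frame_indifferent W"
    and convex: "strictly_rank_one_convex W" and b: "b \<noteq> 0"
  shows "0 < b \<bullet> (gradient W (mat 1) *v b)"
proof -
  define S where "S = gradient W (mat 1)"
  define t where "t = - (2 / (b \<bullet> b))"
  \<comment> \<open>The line is parametrised so that the reflection sits at \<open>s = 1\<close>.
    Since \<open>t\<close> is negative, a negative slope of \<open>g\<close> at 0 is the desired
    positivity.\<close>
  define g where "g s = W (mat 1 + (s * t) *\<^sub>R outer_square b)" for s
  have t: "t < 0"
    using b by (simp add: t_def)
  have "W ((mat 1 + t *\<^sub>R outer_square b) ** mat 1) = W (mat 1)"
    using fi orthogonal_matrix_reflection[OF b] unfolding frame_indifferent_def t_def by blast
  then have g1: "g 1 = g 0"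
    by (simp add: g_def)
  have sc: "g ((1 - r) * x + r * y) < (1 - r) * g x + r * g y"
    if "x \<noteq> y" "0 < r" "r < 1" for x y r
  proof -
    have "strictly_convex_on UNIV (\<lambda>t. W (mat 1 + t *\<^sub>R outer_square b))"
      using convex rank_outer_square[OF b] unfolding strictly_rank_one_convex_def by blast
    moreover have "x * t \<noteq> y * t"
      using that t by simp
    ultimately have "W (mat 1 + ((1 - r) *\<^sub>R (x * t) + r *\<^sub>R (y * t)) *\<^sub>R outer_square b)
        < (1 - r) * g x + r * g y"
      using that unfolding strictly_convex_on_def g_def by blast
    moreover have "(1 - r) *\<^sub>R (x * t) + r *\<^sub>R (y * t) = ((1 - r) * x + r * y) * t"
      by (simp add: algebra_simps)
    ultimately show ?thesis
      by (simp only: g_def)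
  qed
  \<comment> \<open>The chord of \<open>g\<close> over \<open>[0, 1/2]\<close> has slope
    \<open>- 2 * d\<close>, and strict convexity keeps \<open>g\<close> below this chord; the slope
    at 0 must therefore be negative.\<close>
  define d where "d = g 0 - g (1 / 2)"
  have d: "0 < d"
    using sc[of 0 1 "1 / 2"] g1 by (simp add: d_def)
  have "((\<lambda>s. mat 1 + (s * t) *\<^sub>R outer_square b) has_derivative (\<lambda>h. (h * t) *\<^sub>R outer_square b)) (at 0)"
    by (auto intro!: derivative_eq_intros)
  moreover have "(W has_derivative (\<lambda>h. inner h S)) (at (mat 1 + (0 * t) *\<^sub>R outer_square b))"
    using GDERIV_gradient[OF W] by (simp add: gderiv_def S_def)
  ultimately have "(g has_derivative (\<lambda>h. inner ((h * t) *\<^sub>R outer_square b) S)) (at 0)"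
    unfolding g_def by (rule has_derivative_compose)
  then have g': "(g has_real_derivative t * inner (outer_square b) S) (at 0)"
    unfolding has_field_derivative_def by (rule has_derivative_eq_rhs) (auto simp: mult_ac)
  have "t * inner (outer_square b) S < 0"
  proof (rule ccontr)
    assume "\<not> ?thesis"
    then have "0 < t * inner (outer_square b) S + 2 * d"
      using d by linarith
    moreover have "((\<lambda>s. g s + s * (2 * d)) has_real_derivative t * inner (outer_square b) S + 2 * d) (at 0)"
      by (auto intro!: derivative_eq_intros g')
    ultimately obtain e where e: "0 < e" "\<And>h. 0 < h \<Longrightarrow> h < e \<Longrightarrow> g 0 < g h + h * (2 * d)"
      using DERIV_pos_inc_right by force
    \<comment> \<open>Small enough for the local increase, and below \<open>1 / 2\<close> so that
      \<open>2 * h\<close> is a proper convex weight.\<close>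
    define h where "h = min (e / 2) (1 / 4)"
    have h: "0 < h" "h < e" "h < 1 / 2"
      using e by (auto simp: h_def)
    have "g h < (1 - 2 * h) * g 0 + 2 * h * g (1 / 2)"
      using sc[of 0 "1 / 2" "2 * h"] h by simp
    also have "\<dots> = g 0 - h * (2 * d)"
      by (simp add: d_def algebra_simps)
    finally show False
      using e(2)[OF h(1,2)] by simp
  qed
  then have "0 < inner (outer_square b) S"
    using t by (simp add: mult_less_0_iff)
  also have "inner (outer_square b) S = b \<bullet> (S *v b)"
    by (simp add: inner_vec_def outer_square_def matrix_vector_mult_def sum_distrib_left mult_ac)
  finally show ?thesis
    unfolding S_def .
qed

subsection \<open>Regularity of weak solutions\<close>

text \<open>The symmetric part \<open>T\<close> has the same quadratic form as \<open>S\<close>, so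
  positivity makes it injective, hence invertible, and \<open>A\<close> is its inverse.\<close>

lemma elliptic_cutoff_exists:
  fixes S :: "real^'n^'n"
  assumes pos: "\<And>b. b \<noteq> 0 \<Longrightarrow> 0 < b \<bullet> (S *v b)"
  obtains A m F where "elliptic_cutoff S A m F"
proof -
  define T where "T = (1 / 2) *\<^sub>R (S + transpose S)"
  have tS: "x \<bullet> (y v* S) = y \<bullet> (S *v x)" for x y
    by (subst inner_commute) (rule dot_lmul_matrix)
  have T: "x \<bullet> (T *v y) = (x \<bullet> (S *v y) + y \<bullet> (S *v x)) / 2" for x y
    by (simp add: T_def scaleR_matrix_vector_assoc[symmetric] matrix_vector_mult_add_rdistrib
        inner_add_right tS)
  have "inj ((*v) T)"
  proof (rule injI)
    fix x y assume "T *v x = T *v y"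
    then have "(x - y) \<bullet> (T *v (x - y)) = 0"
      by (simp add: matrix_vector_mult_diff_distrib)
    then show "x = y"
      using pos[of "x - y"] T[of "x - y" "x - y"] by auto
  qed
  then obtain A where AT: "A ** T = mat 1"
    using matrix_left_invertible_injective by blast
  then have TA: "T ** A = mat 1"
    using matrix_left_right_inverse by blast
  have TAv: "T *v (A *v x) = x" for x
    by (simp add: matrix_vector_mul_assoc TA)
  have A_sym: "(A *v x) \<bullet> y = x \<bullet> (A *v y)" for x y
  proof -
    have "(A *v x) \<bullet> (T *v (A *v y)) = (A *v y) \<bullet> (T *v (A *v x))"
      by (simp add: T)
    then show ?thesis
      by (simp add: TAv inner_commute)
  qed
  have A_entry: "A $ j $ k = A $ k $ j" for j k
    using A_sym[of "axis k 1" "axis j 1"]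
    by (simp add: matrix_vector_mult_basis column_def inner_axis inner_axis')
  \<comment> \<open>Because \<open>A\<close> is symmetric, \<open>S\<close> and its transpose
    contribute equally to this trace, so each accounts for the full dimension after halving the
    sum.\<close>
  have "trace (T ** A) = real CARD('n)"
    by (simp add: TA trace_I)
  moreover have "trace (T ** A) = (\<Sum>k\<in>UNIV. \<Sum>j\<in>UNIV. (S $ k $ j * A $ j $ k + S $ j $ k * A $ j $ k) / 2)"
    by (simp add: trace_def matrix_matrix_mult_def T_def transpose_def algebra_simps add_divide_distrib)
  moreover have "(\<Sum>k\<in>UNIV. \<Sum>j\<in>UNIV. S $ j $ k * A $ j $ k) = (\<Sum>k\<in>UNIV. \<Sum>j\<in>UNIV. S $ k $ j * A $ j $ k)"
    by (subst sum.swap) (simp add: A_entry)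
  ultimately have tr: "(\<Sum>k\<in>UNIV. \<Sum>j\<in>UNIV. S $ k $ j * A $ j $ k) = real CARD('n)"
    by (simp add: sum_divide_distrib[symmetric] sum.distrib)
  have ASA: "(A *v z) \<bullet> (S *v (A *v z)) = z \<bullet> (A *v z)" for z
    using T[of "A *v z" "A *v z"] by (simp add: TAv inner_commute)
  have A_pos: "0 < z \<bullet> (A *v z)" if "z \<noteq> 0" for z
  proof -
    have "A *v z \<noteq> 0"
      using TAv[of z] that by auto
    from pos[OF this] show ?thesis
      by (simp add: ASA)
  qed
  have A_cont: "continuous_on (sphere 0 1) (\<lambda>z. z \<bullet> (A *v z))"
    by (intro continuous_intros bounded_linear.continuous_on[OF matrix_vector_mul_bounded_linear])
  \<comment> \<open>The ellipticity constant is the minimum of the quadratic form on the unit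
    sphere; homogeneity extends the bound to all vectors.\<close>
  obtain z0 where z0: "z0 \<in> sphere 0 1" "\<And>z. z \<in> sphere 0 1 \<Longrightarrow> z0 \<bullet> (A *v z0) \<le> z \<bullet> (A *v z)"
    using continuous_attains_inf[OF compact_sphere _ A_cont] by (auto simp: sphere_eq_empty)
  define m where "m = z0 \<bullet> (A *v z0)"
  have m: "0 < m"
    unfolding m_def by (rule A_pos) (use z0(1) in auto)
  have coercive: "m * (norm z)\<^sup>2 \<le> z \<bullet> (A *v z)" for z
  proof (cases "z = 0")
    case False
    then have "m \<le> (z /\<^sub>R norm z) \<bullet> (A *v (z /\<^sub>R norm z))"
      unfolding m_def by (intro z0(2)) simp
    with False show ?thesis
      by (simp add: matrix_vector_mult_scaleR field_simps power2_eq_square)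
  qed simp
  obtain F where "\<And>k s. (F k has_real_derivative F (Suc k) s) (at s)"
    and "\<And>k s. 1 \<le> s \<Longrightarrow> F k s = 0" and "\<And>s. s < 1 \<Longrightarrow> 0 < F 1 s"
    using smooth_cutoff_exists by blast
  then have "elliptic_cutoff S A m F"
    using A_sym tr ASA m coercive by unfold_locales auto
  then show thesis ..
qed

lemma weak_solution_C1:
  fixes v :: "real^'n \<Rightarrow> real"
  assumes pos: "\<And>b. b \<noteq> 0 \<Longrightarrow> 0 < b \<bullet> (S *v b)"
    and weak: "\<And>\<psi>. \<psi> \<in> test_functions \<Omega> \<Longrightarrow> (LINT y:\<Omega>|lebesgue. v y * second_order S \<psi> y) = 0"
    and cont: "continuous_on \<Omega> v" and "open \<Omega>"
  shows "Ck_on 1 \<Omega> v"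
proof -
  obtain A m F where "elliptic_cutoff S A m F"
    using elliptic_cutoff_exists[OF pos] by blast
  then interpret elliptic_cutoff S A m F .
  have "v differentiable (at x) \<and> isCont (\<lambda>x. frechet_derivative v (at x) h) x" if x: "x \<in> \<Omega>" for x h
  proof -
    obtain r D where r: "0 < r" and D: "continuous_on (ball x r) D"
      and v': "\<And>y. y \<in> ball x r \<Longrightarrow> (v has_derivative blinfun_apply (D y)) (at y)"
      using weak_solution_locally_C1[OF weak cont \<open>open \<Omega>\<close> x] by blast
    have "continuous_on (ball x r) (\<lambda>y. blinfun_apply (D y) h)"
      by (intro continuous_intros D)
    moreover have "frechet_derivative v (at y) h = blinfun_apply (D y) h" if "y \<in> ball x r" for y
      using frechet_derivative_at[OF v'[OF that]] by simp
    ultimately have "continuous_on (ball x r) (\<lambda>y. frechet_derivative v (at y) h)"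
      by (metis (no_types, lifting) continuous_on_cong)
    then have "isCont (\<lambda>y. frechet_derivative v (at y) h) x"
      using r by (simp add: continuous_on_eq_continuous_at)
    moreover have "v differentiable (at x)"
      using v'[of x] r unfolding differentiable_def by auto
    ultimately show ?thesis
      by blast
  qed
  then show ?thesis
    by (auto intro: continuous_at_imp_continuous_on)
qed

section \<open>Reduction of the vectorial problem to scalar equations\<close>

lemma Ck_on_1_componentwise:
  fixes u :: "real^'n \<Rightarrow> real^'m"
  assumes "\<And>i. Ck_on 1 \<Omega> (\<lambda>x. u x $ i)"
  shows "Ck_on 1 \<Omega> u"
proof -
  define D where "D x = (\<lambda>h. \<chi> i. frechet_derivative (\<lambda>x. u x $ i) (at x) h)" for x
  have D: "(u has_derivative D x) (at x)" if "x \<in> \<Omega>" for x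
  proof -
    have "((\<lambda>x. u x $ i) has_derivative (\<lambda>h. D x h $ i)) (at x)" for i
      using assms[of i] that by (simp add: D_def frechet_derivative_works[symmetric])
    then show ?thesis
      by (auto simp: has_derivative_componentwise_within[of u] Basis_vec_def inner_axis)
  qed
  have "continuous_on \<Omega> (\<lambda>x. D x h)" for h
    unfolding D_def using assms by (intro continuous_on_vec_lambda) simp
  moreover have "frechet_derivative u (at x) = D x" if "x \<in> \<Omega>" for x
    using frechet_derivative_at[OF D[OF that]] by simp
  ultimately have "continuous_on \<Omega> (\<lambda>x. frechet_derivative u (at x) h)" for h
    by (simp cong: continuous_on_cong)
  then show ?thesis
    using D by (auto simp: differentiable_def)
qed

text \<open>A test function is bounded and vanishes off a compact subset of \<open>\<Omega>\<close>,
  so local integrability of \<open>g\<close> suffices.\<close>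

lemma integrable_times_test_function:
  fixes g :: "real^'n \<Rightarrow> real"
  assumes g: "\<And>K. compact K \<Longrightarrow> K \<subseteq> \<Omega> \<Longrightarrow> set_integrable lebesgue K g" and \<phi>: "\<phi> \<in> test_functions \<Omega>"
  shows "set_integrable lebesgue \<Omega> (\<lambda>x. g x * \<phi> x)"
proof -
  define K where "K = closure {x. \<phi> x \<noteq> 0}"
  have K: "compact K" "K \<subseteq> \<Omega>"
    using \<phi> by (auto simp: K_def test_functions_def)
  have "bounded (\<phi> ` K)"
    by (intro compact_imp_bounded compact_continuous_image test_functionsD(3)[OF \<phi>] K(1))
  moreover have "\<phi> \<in> borel_measurable (lebesgue_on K)"
    using K(1) by (intro continuous_imp_measurable_on_sets_lebesgue test_functionsD(3)[OF \<phi>])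
      (auto intro: lmeasurable_compact fmeasurableD)
  ultimately have "set_integrable lebesgue K (\<lambda>x. \<phi> x * g x)"
    using K g by (intro absolutely_integrable_bounded_measurable_product[OF bilinear_times])
      (auto intro: lmeasurable_compact fmeasurableD)
  moreover have "indicator K x *\<^sub>R (\<phi> x * g x) = indicator \<Omega> x *\<^sub>R (g x * \<phi> x)" for x
    using K(2) closure_subset[of "{x. \<phi> x \<noteq> 0}"] unfolding K_def by (auto simp: indicator_def)
  ultimately show ?thesis
    unfolding set_integrable_def by (simp only:)
qed

lemma jacobian_scaleR_axis:
  assumes "\<psi> differentiable (at x)"
  shows "jacobian (\<lambda>x. \<psi> x *\<^sub>R axis i 1) (at x) $ a $ b =
    (if a = i then frechet_derivative \<psi> (at x) (axis b 1) else 0)"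
proof -
  have "((\<lambda>x. \<psi> x *\<^sub>R axis i 1) has_derivative (\<lambda>h. frechet_derivative \<psi> (at x) h *\<^sub>R axis i 1)) (at x)"
    using assms by (intro has_derivative_scaleR_left) (simp add: frechet_derivative_works[symmetric])
  note deriv = frechet_derivative_at[OF this, symmetric]
  show ?thesis
    unfolding jacobian_def matrix_def deriv by (simp add: axis_def[of i])
qed

text \<open>Testing the system with \<open>\<psi>\<close> times the i-th unit vector isolates row
  \<open>i\<close> of \<open>DW(Du) = Du S\<close>. The definition of the weak derivative, applied
  to the partial derivatives of \<open>\<psi>\<close>, then moves the remaining derivative from
  \<open>u\<close> onto \<open>\<psi>\<close>.\<close>

lemma weak_solution_component:
  fixes W :: "real^'n^'n \<Rightarrow> real" and u :: "real^'n \<Rightarrow> real^'n"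
  assumes "open \<Omega>" and C1: "Ck_on 1 UNIV W" and fi: "frame_indifferent W"
    and u: "u \<in> W1inf \<Omega>"
    and orth: "AE x in lebesgue_on \<Omega>. orthogonal_matrix (weak_jacobian \<Omega> u x)"
    and EL: "weak_solution_EL W \<Omega> u"
    and \<psi>: "\<psi> \<in> test_functions \<Omega>"
  shows "(LINT x:\<Omega>|lebesgue. u x $ i * second_order (gradient W (mat 1)) \<psi> x) = 0"
proof -
  define S where "S = gradient W (mat 1)"
  define G where "G = weak_jacobian \<Omega> u"
  define d where "d b = (\<lambda>x. frechet_derivative \<psi> (at x) (axis b 1))" for b
  have d: "d b \<in> test_functions \<Omega>" for b
    unfolding d_def by (rule test_functions_frechet_derivative[OF \<psi>])
  have \<Omega>: "\<Omega> \<in> sets lebesgue"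
    using \<open>open \<Omega>\<close> by (simp add: borel_open)
  \<comment> \<open>Membership in \<open>W1inf\<close> provides some weak derivative, so the one
    picked by \<open>SOME\<close> is one as well.\<close>
  have "has_weak_jacobian \<Omega> u G"
    using u someI_ex[of "has_weak_jacobian \<Omega> u"]
    unfolding G_def weak_jacobian_def W1inf_def by blast
  then have G_loc: "locally_integrable_on \<Omega> G" and u_loc: "locally_integrable_on \<Omega> u"
    and G_eq: "\<And>\<phi> i j. \<phi> \<in> test_functions \<Omega> \<Longrightarrow>
      (LINT x:\<Omega>|lebesgue. u x $ i * frechet_derivative \<phi> (at x) (axis j 1)) =
      - (LINT x:\<Omega>|lebesgue. G x $ i $ j * \<phi> x)"
    unfolding has_weak_jacobian_def by auto
  have u_int: "set_integrable lebesgue \<Omega> (\<lambda>x. u x $ i * \<phi> x)" if "\<phi> \<in> test_functions \<Omega>" for \<phi>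
  proof (rule integrable_times_test_function[OF _ that])
    show "set_integrable lebesgue K (\<lambda>x. u x $ i)" if "compact K" "K \<subseteq> \<Omega>" for K
      using absolutely_integrable_linear[OF _ bounded_linear_vec_nth, where f = u and s = K] u_loc that
      by (simp add: locally_integrable_on_def o_def)
  qed
  have G_int: "set_integrable lebesgue \<Omega> (\<lambda>x. G x $ i $ k * \<phi> x)" if "\<phi> \<in> test_functions \<Omega>" for k \<phi>
  proof (rule integrable_times_test_function[OF _ that])
    show "set_integrable lebesgue K (\<lambda>x. G x $ i $ k)" if "compact K" "K \<subseteq> \<Omega>" for K
      using absolutely_integrable_linear[OF _ bounded_linear_compose[OF bounded_linear_vec_nth
            bounded_linear_vec_nth], where f = G and s = K] G_loc that
      by (simp add: locally_integrable_on_def o_def)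
  qed
  \<comment> \<open>\<open>p\<close> is the linear integrand obtained from \<open>Du S\<close>,
    \<open>e\<close> the actual Euler-Lagrange integrand; they agree wherever \<open>G x\<close> is
    orthogonal.\<close>
  define p where "p x = (\<Sum>k\<in>UNIV. \<Sum>b\<in>UNIV. S $ k $ b * (G x $ i $ k * d b x))" for x
  define e where "e x = inner (gradient W (G x)) (jacobian (\<lambda>x. \<psi> x *\<^sub>R axis i 1) (at x))" for x
  have inner_jacobian: "inner X (jacobian (\<lambda>x. \<psi> x *\<^sub>R axis i 1) (at x)) = (\<Sum>b\<in>UNIV. X $ i $ b * d b x)" for X x
  proof -
    have "inner X (jacobian (\<lambda>x. \<psi> x *\<^sub>R axis i 1) (at x)) =
        (\<Sum>a\<in>UNIV. if a = i then \<Sum>b\<in>UNIV. X $ i $ b * d b x else 0)"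
      unfolding inner_vec_def d_def
      by (intro sum.cong) (auto simp: jacobian_scaleR_axis[OF test_functionsD(1)[OF \<psi>]])
    then show ?thesis
      by simp
  qed
  have e_p: "e x = p x" if "orthogonal_matrix (G x)" for x
  proof -
    have "gradient W (G x) = G x ** S"
      unfolding S_def using C1 by (intro gradient_frame_indifferent fi that) simp
    then have "e x = (\<Sum>b\<in>UNIV. (\<Sum>k\<in>UNIV. G x $ i $ k * S $ k $ b) * d b x)"
      unfolding e_def inner_jacobian by (simp add: matrix_matrix_mult_def)
    also have "\<dots> = (\<Sum>b\<in>UNIV. \<Sum>k\<in>UNIV. S $ k $ b * (G x $ i $ k * d b x))"
      by (simp add: sum_distrib_left sum_distrib_right mult_ac)
    also have "\<dots> = p x"
      unfolding p_def by (rule sum.swap)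
    finally show ?thesis .
  qed
  have sum_int: "set_integrable lebesgue \<Omega> (\<lambda>x. \<Sum>k\<in>UNIV. \<Sum>b\<in>UNIV. S $ k $ b * f k b x)"
    and sum_eq: "(LINT x:\<Omega>|lebesgue. \<Sum>k\<in>UNIV. \<Sum>b\<in>UNIV. S $ k $ b * f k b x) =
      (\<Sum>k\<in>UNIV. \<Sum>b\<in>UNIV. S $ k $ b * (LINT x:\<Omega>|lebesgue. f k b x))"
    if f: "\<And>k b. set_integrable lebesgue \<Omega> (f k b)" for f :: "'n \<Rightarrow> 'n \<Rightarrow> real^'n \<Rightarrow> real"
  proof -
    have "indicator \<Omega> x *\<^sub>R (\<Sum>k\<in>UNIV. \<Sum>b\<in>UNIV. S $ k $ b * f k b x) =
        (\<Sum>k\<in>UNIV. \<Sum>b\<in>UNIV. S $ k $ b * (indicator \<Omega> x *\<^sub>R f k b x))" for x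
      by (simp add: sum_distrib_left mult_ac)
    moreover have "integrable lebesgue (\<lambda>x. indicator \<Omega> x *\<^sub>R f k b x)" for k b
      using f unfolding set_integrable_def .
    ultimately show "set_integrable lebesgue \<Omega> (\<lambda>x. \<Sum>k\<in>UNIV. \<Sum>b\<in>UNIV. S $ k $ b * f k b x)"
      and "(LINT x:\<Omega>|lebesgue. \<Sum>k\<in>UNIV. \<Sum>b\<in>UNIV. S $ k $ b * f k b x) =
      (\<Sum>k\<in>UNIV. \<Sum>b\<in>UNIV. S $ k $ b * (LINT x:\<Omega>|lebesgue. f k b x))"
      unfolding set_integrable_def set_lebesgue_integral_def
      by (simp_all add: Bochner_Integration.integral_sum Bochner_Integration.integral_mult_right)
  qed
  have p_int: "set_integrable lebesgue \<Omega> p"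
    unfolding p_def by (intro sum_int G_int d)
  have AE: "AE x in lebesgue. indicator \<Omega> x *\<^sub>R p x = indicator \<Omega> x *\<^sub>R e x"
    using orth \<Omega> e_p by (auto simp: AE_restrict_space_iff G_def indicator_def elim!: eventually_mono)
  have p_meas: "(\<lambda>x. indicator \<Omega> x *\<^sub>R p x) \<in> borel_measurable lebesgue"
    using p_int unfolding set_integrable_def by (rule borel_measurable_integrable)
  \<comment> \<open>Measurability of \<open>e\<close> is inherited from \<open>p\<close> through
    almost everywhere equality, by completeness of Lebesgue measure.\<close>
  have "(LINT x:\<Omega>|lebesgue. p x) = (LINT x:\<Omega>|lebesgue. e x)"
    unfolding set_lebesgue_integral_def
    by (rule integral_cong_AE[OF p_meas borel_measurable_AE[OF p_meas AE] AE])
  also have "\<dots> = 0"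
    using EL test_functions_scaleR[OF \<psi>, of "axis i 1"]
    unfolding weak_solution_EL_def e_def G_def by blast
  finally have "(LINT x:\<Omega>|lebesgue. p x) = 0" .
  moreover have "(LINT x:\<Omega>|lebesgue. p x) =
      (\<Sum>k\<in>UNIV. \<Sum>b\<in>UNIV. S $ k $ b * (LINT x:\<Omega>|lebesgue. G x $ i $ k * d b x))"
    unfolding p_def by (intro sum_eq G_int d)
  moreover have "\<dots> = - (\<Sum>k\<in>UNIV. \<Sum>b\<in>UNIV. S $ k $ b *
      (LINT x:\<Omega>|lebesgue. u x $ i * frechet_derivative (d b) (at x) (axis k 1)))"
    by (simp add: G_eq[OF d] sum_negf)
  moreover have "(\<Sum>k\<in>UNIV. \<Sum>b\<in>UNIV. S $ k $ b *
      (LINT x:\<Omega>|lebesgue. u x $ i * frechet_derivative (d b) (at x) (axis k 1))) =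
      (LINT x:\<Omega>|lebesgue. \<Sum>k\<in>UNIV. \<Sum>b\<in>UNIV. S $ k $ b *
        (u x $ i * frechet_derivative (d b) (at x) (axis k 1)))"
    by (intro sum_eq[symmetric] u_int test_functions_frechet_derivative d)
  ultimately show ?thesis
    unfolding second_order_def S_def[symmetric] d_def by (simp add: sum_distrib_left mult_ac)
qed

text \<open>Continuity of \<open>u\<close> on \<open>\<Omega>\<close> encodes the passage to the
  continuous representative; the failure of \<open>C^1\<close> regularity refers to this
  representative.\<close>

theorem theorem0p2:
  fixes \<Omega> :: "(real^'n) set"
    and W :: "real^'n^'n \<Rightarrow> real"
    and u :: "real^'n \<Rightarrow> real^'n"
  assumes "open \<Omega>" and "connected \<Omega>" and "\<Omega> \<noteq> {}"
    and "Ck_on 1 UNIV W"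
    and "frame_indifferent W"
    and "strictly_rank_one_convex W"
    and "u \<in> W1inf \<Omega>" and "continuous_on \<Omega> u"
    and "AE x in lebesgue_on \<Omega>. orthogonal_matrix (weak_jacobian \<Omega> u x)"
    and "\<not> Ck_on 1 \<Omega> u"
  shows "\<not> weak_solution_EL W \<Omega> u"
proof
  assume EL: "weak_solution_EL W \<Omega> u"
  have W: "W differentiable (at (mat 1))"
    using \<open>Ck_on 1 UNIV W\<close> by simp
  have "Ck_on 1 \<Omega> (\<lambda>x. u x $ i)" for i
  proof (rule weak_solution_C1)
    show "0 < b \<bullet> (gradient W (mat 1) *v b)" if "b \<noteq> 0" for b
      using gradient_identity_positive[OF W assms(5,6) that] .
    show "(LINT x:\<Omega>|lebesgue. u x $ i * second_order (gradient W (mat 1)) \<psi> x) = 0"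
      if "\<psi> \<in> test_functions \<Omega>" for \<psi>
      by (rule weak_solution_component[OF assms(1,4,5,7,9) EL that])
  qed (use assms in \<open>auto intro: continuous_intros\<close>)
  then have "Ck_on 1 \<Omega> u"
    by (rule Ck_on_1_componentwise)
  with assms(10) show False ..
qed

end
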